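(* Consider the finite-horizon mean-field game with horizon $H=2$, state space $S=\{0,1,2\}$, action space $A=\{L,R\}$, initial distribution $\mu_0=\delta_0$, transition kernel (independent of the state measure) given by $P(1\mid 0,L)=1$, $P(2\mid 0,R)=1$, $P(s\mid s,a)=1$ for $s\in\{1,2\}$, $a\in A$, and all other transition probabilities $0$, and reward $r(0,a,\mu)=0$, $r(1,a,\mu)=-\mu(1)$, $r(2,a,\mu)=-\mu(2)$ for all $a\in A$, $\mu\in\mathcal P(S)$. Then: 1. The game satisfies Assumptions 1 (weak monotonicity), 2 (kernel independent of the state measure) and 3 (Lipschitz reward) stated in the context. 2. Let $\mathcal K$ and $F$ be the occupation-flow polytope and mean-field occupation operator of this game, and let $\rho^0\in\mathcal K$ be the occupation flow with $\rho^0_0(0,L)=1$, $\rho^0_0(0,R)=0$, $\rho^0_1(1,L)=\rho^0_1(1,R)=\tfrac12$, $\rho^0_1(2,L)=\rho^0_1(2,R)=0$, and all other coordinates $0$. Let $(\rho^k)_{k\ge0}$ be generated from $\rho^0$ by $$\rho^{k+1}=\Pi_{\mathcal K}\big((1-\beta_k)\rho^k+\beta_k\rho^0-\alpha_kF(\rho^k)\big),\qquad \alpha_k=\frac1{6\sqrt{k+2}},\quad\beta_k=\frac{2}{k+2}.$$ Then for every $k\ge1$, $$r^{\mathrm{tan}}_{F,N_{\mathcal K}}(\rho^k)\ge\frac{1}{\sqrt{3(k+2)}}.$$ In particular, $r^{\mathrm{tan}}_{F,N_{\mathcal K}}(\rho^k)=\Omega(k^{-1/2})$.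
   Context: A finite-horizon mean-field game $(S,A,r,P,\mu_0,H)$ has finite state and action spaces $S,A$, reward $r:S\times A\times\mathcal P(S)\to\mathbb R$, transition kernel $P$, initial distribution $\mu_0\in\mathcal P(S)$ and horizon $H$; $\mathcal P(S)$ is the set of probability measures on $S$, and times are $h=0,\dots,H-1$. A policy flow is $\pi=(\pi_h)_{h=0}^{H-1}$ with $\pi_h(\cdot\mid s)\in\mathcal P(A)$. Assumption 2: $P(\cdot\mid s,a,\mu)=P(\cdot\mid s,a)$ for all $\mu\in\mathcal P(S)$. Given a policy flow $\pi$, its state flow is $\mu^\pi_0=\mu_0$, $\mu^\pi_{h+1}(s')=\sum_{s,a}P(s'\mid s,a)\pi_h(a\mid s)\mu^\pi_h(s)$, and its occupation flow is $\rho^\pi_h(s,a)=\pi_h(a\mid s)\mu^\pi_h(s)$. Assumption 1 (weak monotonicity): for all policy flows $\pi,\tilde\pi$, $\sum_{h=0}^{H-1}\sum_{s,a}\big(r(s,a,\mu^\pi_h)-r(s,a,\mu^{\tilde\pi}_h)\big)\big(\rho^\pi_h(s,a)-\rho^{\tilde\pi}_h(s,a)\big)\le 0$. Assumption 3: there is a constant $L_r$ with $|r(s,a,\mu)-r(s,a,\tilde\mu)|\le L_r\|\mu-\tilde\mu\|_{\mathrm{TV}}$ for all $(s,a)$ and $\mu,\tilde\mu\in\mathcal P(S)$, where $\|\mu-\tilde\mu\|_{\mathrm{TV}}=\sum_s|\mu(s)-\tilde\mu(s)|$. $\mathcal K$ is the set of $\rho=(\rho_h)_{h=0}^{H-1}\in\prod_{h=0}^{H-1}\mathbb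 R_+^{S\times A}$ with $\sum_a\rho_0(s,a)=\mu_0(s)$ for all $s$, and $\sum_a\rho_{h+1}(s',a)=\sum_{s,a}P(s'\mid s,a)\rho_h(s,a)$ for all $s'\in S$, $h=0,\dots,H-2$. For $\rho\in\mathcal K$, $\mu^\rho_h(s)=\sum_a\rho_h(s,a)$ and $F:\mathcal K\to\mathbb R^{H|S||A|}$ is $[F(\rho)]_{h,s,a}=-r(s,a,\mu^\rho_h)$. $\Pi_{\mathcal K}$ is the Euclidean projection onto $\mathcal K$. For $x\in\mathcal K$, $N_{\mathcal K}(x)=\{g\in\mathbb R^{H|S||A|}:\langle g,y-x\rangle\le 0\ \forall y\in\mathcal K\}$, and $r^{\mathrm{tan}}_{F,N_{\mathcal K}}(\rho)=\inf_{c\in N_{\mathcal K}(\rho)}\|F(\rho)+c\|_2$. *)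

theory Defs
  imports "HOL-Analysis.Analysis" "HOL-Library.Landau_Symbols"
begin

section \<open>Finite-horizon mean-field games\<close>

definition prob_simplex :: "('x::finite \<Rightarrow> real) set" where
  "prob_simplex = {\<mu>. (\<forall>x. 0 \<le> \<mu> x) \<and> (\<Sum>x\<in>UNIV. \<mu> x) = 1}"

definition dirac :: "'x \<Rightarrow> 'x \<Rightarrow> real" where
  "dirac x = (\<lambda>y. if y = x then 1 else 0)"

definition tv_norm :: "('s::finite \<Rightarrow> real) \<Rightarrow> real" where
  "tv_norm \<nu> = (\<Sum>s\<in>UNIV. \<bar>\<nu> s\<bar>)"

text \<open>
  Reward and kernel take a state measure as an argument of type \<open>'s \<Rightarrow> real\<close>; only their values at
  elements of \<open>prob_simplex\<close> are meaningful. The number \<open>kernel G s a \<mu> s'\<close> is $P(s' | s, a, \mu)$.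
\<close>

record ('s, 'a) mfg =
  reward  :: "'s \<Rightarrow> 'a \<Rightarrow> ('s \<Rightarrow> real) \<Rightarrow> real"
  kernel  :: "'s \<Rightarrow> 'a \<Rightarrow> ('s \<Rightarrow> real) \<Rightarrow> 's \<Rightarrow> real"
  init    :: "'s \<Rightarrow> real"
  horizon :: nat

definition is_mfg :: "('s::finite, 'a::finite) mfg \<Rightarrow> bool" where
  "is_mfg G \<longleftrightarrow> 0 < horizon G \<and> init G \<in> prob_simplex \<and>
     (\<forall>s a. \<forall>\<mu>\<in>prob_simplex. kernel G s a \<mu> \<in> prob_simplex)"

definition is_policy_flow :: "('s::finite, 'a::finite) mfg \<Rightarrow> (nat \<Rightarrow> 's \<Rightarrow> 'a \<Rightarrow> real) \<Rightarrow> bool" where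
  "is_policy_flow G \<pi> \<longleftrightarrow> (\<forall>h<horizon G. \<forall>s. \<pi> h s \<in> prob_simplex)"

primrec state_flow ::
  "('s::finite, 'a::finite) mfg \<Rightarrow> (nat \<Rightarrow> 's \<Rightarrow> 'a \<Rightarrow> real) \<Rightarrow> nat \<Rightarrow> 's \<Rightarrow> real" where
  "state_flow G \<pi> 0 = init G"
| "state_flow G \<pi> (Suc h) =
     (\<lambda>s'. \<Sum>s\<in>UNIV. \<Sum>a\<in>UNIV.
        kernel G s a (state_flow G \<pi> h) s' * \<pi> h s a * state_flow G \<pi> h s)"

definition occupation_flow ::
  "('s::finite, 'a::finite) mfg \<Rightarrow> (nat \<Rightarrow> 's \<Rightarrow> 'a \<Rightarrow> real) \<Rightarrow> nat \<Rightarrow> 's \<Rightarrow> 'a \<Rightarrow> real" where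
  "occupation_flow G \<pi> h s a = \<pi> h s a * state_flow G \<pi> h s"

definition weakly_monotone :: "('s::finite, 'a::finite) mfg \<Rightarrow> bool" where
  "weakly_monotone G \<longleftrightarrow>
     (\<forall>\<pi> \<pi>'. is_policy_flow G \<pi> \<longrightarrow> is_policy_flow G \<pi>' \<longrightarrow>
        (\<Sum>h<horizon G. \<Sum>s\<in>UNIV. \<Sum>a\<in>UNIV.
           (reward G s a (state_flow G \<pi> h) - reward G s a (state_flow G \<pi>' h)) *
           (occupation_flow G \<pi> h s a - occupation_flow G \<pi>' h s a)) \<le> 0)"

definition kernel_measure_independent :: "('s::finite, 'a::finite) mfg \<Rightarrow> bool" where
  "kernel_measure_independent G \<longleftrightarrow>
     (\<exists>P. \<forall>s a. \<forall>\<mu>\<in>prob_simplex. kernel G s a \<mu> = P s a)"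

definition lipschitz_reward :: "('s::finite, 'a::finite) mfg \<Rightarrow> bool" where
  "lipschitz_reward G \<longleftrightarrow>
     (\<exists>L. \<forall>s a. \<forall>\<mu>\<in>prob_simplex. \<forall>\<nu>\<in>prob_simplex.
        \<bar>reward G s a \<mu> - reward G s a \<nu>\<bar> \<le> L * tv_norm (\<lambda>s'. \<mu> s' - \<nu> s'))"

section \<open>Occupation-flow polytope and operator\<close>

text \<open>
  A point of $\mathbb R^{H|S||A|}$ is an element of \<open>real^'a^'s^'h\<close>, whose norm and inner product are
  the Euclidean ones, with coordinates \<open>\<rho> $ h $ s $ a\<close>. The index type \<open>'h\<close> is a finite linear
  order with \<open>CARD('h)\<close> equal to the horizon of the game, and \<open>time h\<close> is its \<open>h\<close>-th element,
  counted from 0.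
\<close>

definition time :: "nat \<Rightarrow> 'h::{finite, linorder}" where
  "time h = sorted_list_of_set UNIV ! h"

definition marginal :: "real^'a^'s^'h \<Rightarrow> 'h \<Rightarrow> 's \<Rightarrow> real" where
  "marginal \<rho> h = (\<lambda>s. \<Sum>a\<in>UNIV. \<rho> $ h $ s $ a)"

text \<open>
  For a measure-independent kernel the measure argument below is immaterial; every \<open>\<rho>\<close> in the
  polytope has marginals in \<open>prob_simplex\<close>.
\<close>

definition occupation_polytope ::
  "('s::finite, 'a::finite) mfg \<Rightarrow> (real^'a^'s^('h::{finite, linorder})) set" where
  "occupation_polytope G = {\<rho>.
     (\<forall>h s a. 0 \<le> \<rho> $ h $ s $ a) \<and>
     (\<forall>s. (\<Sum>a\<in>UNIV. \<rho> $ time 0 $ s $ a) = init G s) \<and>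
     (\<forall>h. Suc h < horizon G \<longrightarrow> (\<forall>s'.
        (\<Sum>a\<in>UNIV. \<rho> $ time (Suc h) $ s' $ a) =
        (\<Sum>s\<in>UNIV. \<Sum>a\<in>UNIV.
           kernel G s a (marginal \<rho> (time h)) s' * \<rho> $ time h $ s $ a)))}"

definition mf_operator ::
  "('s::finite, 'a::finite) mfg \<Rightarrow> real^'a^'s^'h \<Rightarrow> real^'a^'s^'h" where
  "mf_operator G \<rho> = (\<chi> h s a. - reward G s a (marginal \<rho> h))"

definition normal_cone :: "'v::real_inner set \<Rightarrow> 'v \<Rightarrow> 'v set" where
  "normal_cone K x = {g. \<forall>y\<in>K. g \<bullet> (y - x) \<le> 0}"

definition tangent_residual :: "('v::real_inner \<Rightarrow> 'v) \<Rightarrow> 'v set \<Rightarrow> 'v \<Rightarrow> real" where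
  "tangent_residual F K x = (INF c\<in>normal_cone K x. norm (F x + c))"

section \<open>The two-stage game\<close>

datatype action = L | R

instance action :: finite
proof
  have "(UNIV :: action set) \<subseteq> {L, R}"
    using action.exhaust by auto
  then show "finite (UNIV :: action set)"
    by (rule finite_subset) simp
qed

definition example_game :: "(3, action) mfg" where
  "example_game = \<lparr>
     reward = (\<lambda>s a \<mu>. if s = 0 then 0 else - \<mu> s),
     kernel = (\<lambda>s a \<mu>. if s = 0 then (case a of L \<Rightarrow> dirac 1 | R \<Rightarrow> dirac 2) else dirac s),
     init = dirac 0,
     horizon = 2\<rparr>"

definition rho0 :: "real^action^3^2" where
  "rho0 = (\<chi> h s a.
     if h = time 0 \<and> s = 0 \<and> a = L then 1
     else if h = time 1 \<and> s = 1 then 1/2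
     else 0)"

end

theory Submission
  imports Defs
begin

text \<open>
  By symmetry in the second-stage actions, the iterates stay on the segment of flows \<open>split_flow p\<close>,
  which send mass \<open>p\<close> to state 1, and on it the recursion reads
  $u_{k+1} = (1 - \beta_k - 2\alpha_k/3) u_k + \beta_k/2$ for $u = p - 1/2$. The anchor term
  $\beta_k/2 = 1/(k+2)$ dominates the loss and keeps $u_k \ge 1/(2\sqrt{k+2})$, while testing the
  residual against the feasible direction towards \<open>split_flow 0\<close> bounds it below by
  $2 u_k/\sqrt 3$.
\<close>

section \<open>Projections and tangent residuals in general\<close>

text \<open>The obtuse-angle condition upgrades the expansion of the squared distance to a
  Pythagorean inequality. Hence \<open>x\<close> is a minimiser, and every other minimiser has
  distance 0 from it, which settles the choice operator in \<open>closest_point\<close>.\<close>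

lemma closest_point_eqI:
  fixes S :: "'v::euclidean_space set"
  assumes "x \<in> S" and obtuse: "\<And>y. y \<in> S \<Longrightarrow> (a - x) \<bullet> (y - x) \<le> 0"
  shows "closest_point S a = x"
proof -
  have pythagoras: "(dist a x)\<^sup>2 + (dist x y)\<^sup>2 \<le> (dist a y)\<^sup>2" if "y \<in> S" for y
  proof -
    have "(dist a y)\<^sup>2 = (dist a x)\<^sup>2 + (dist x y)\<^sup>2 - 2 * ((a - x) \<bullet> (y - x))"
      by (simp add: dist_norm power2_norm_eq_inner algebra_simps inner_commute)
    then show ?thesis
      using obtuse[OF that] by simp
  qed
  have closer: "dist a x \<le> dist a y" if "y \<in> S" for y
  proof (rule power2_le_imp_le)
    show "(dist a x)\<^sup>2 \<le> (dist a y)\<^sup>2"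
      using pythagoras[OF that] zero_le_power2[of "dist x y"] by linarith
  qed simp
  show ?thesis
    unfolding closest_point_def
  proof (rule some_equality)
    show "x \<in> S \<and> (\<forall>y\<in>S. dist a x \<le> dist a y)"
      using \<open>x \<in> S\<close> closer by blast
  next
    fix y
    assume y: "y \<in> S \<and> (\<forall>z\<in>S. dist a y \<le> dist a z)"
    then have "(dist a y)\<^sup>2 \<le> (dist a x)\<^sup>2"
      using \<open>x \<in> S\<close> by (simp add: power_mono)
    moreover have "(dist a x)\<^sup>2 + (dist x y)\<^sup>2 \<le> (dist a y)\<^sup>2"
      using y pythagoras by blast
    ultimately have "(dist x y)\<^sup>2 \<le> 0"
      by linarith
    then show "y = x"
      by simp
  qed
qed

text \<open>A normal vector makes a nonpositive inner product with the feasible direction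
  \<open>y - x\<close>, so adding it to \<open>F x\<close> cannot weaken the descent along that
  direction; Cauchy-Schwarz turns the descent into a bound on the norm.\<close>

lemma tangent_residual_ge:
  assumes "y \<in> K" and slope: "c * norm (y - x) \<le> - (F x \<bullet> (y - x))" and "y \<noteq> x"
  shows "c \<le> tangent_residual F K x"
  unfolding tangent_residual_def
proof (rule cINF_greatest)
  \<comment> \<open>The infimum can be bounded through its members only over a nonempty set.\<close>
  have "0 \<in> normal_cone K x"
    by (simp add: normal_cone_def)
  then show "normal_cone K x \<noteq> {}"
    by blast
next
  fix g
  assume "g \<in> normal_cone K x"
  then have "g \<bullet> (y - x) \<le> 0"
    using \<open>y \<in> K\<close> by (simp add: normal_cone_def)
  then have "c * norm (y - x) \<le> - ((F x + g) \<bullet> (y - x))"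
    using slope by (simp add: inner_add_left)
  also have "\<dots> \<le> norm (F x + g) * norm (y - x)"
    using Cauchy_Schwarz_ineq2[of "F x + g" "y - x"] by linarith
  finally show "c \<le> norm (F x + g)"
    using \<open>y \<noteq> x\<close> by simp
qed

section \<open>Enumeration of actions, states and times\<close>

lemma UNIV_action: "UNIV = {L, R}"
proof (rule UNIV_eq_I)
  show "a \<in> {L, R}" for a
    by (cases a) simp_all
qed

lemma sum_action: "(\<Sum>a\<in>UNIV. f a) = f L + f R"
  by (simp add: UNIV_action)

lemma all_action: "(\<forall>a. P a) \<longleftrightarrow> P L \<and> P R"
  unfolding ball_UNIV[symmetric] UNIV_action by simp

text \<open>\<open>sum_3\<close> enumerates the type as 1, 2, 3, whereas the game names its states
  0, 1, 2; the numeral 3 wraps around to 0.\<close>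

lemma sum_3_from_0: "(\<Sum>s\<in>UNIV. f s) = f 0 + f 1 + f (2::3)"
proof -
  have "(3::3) = 0"
    by simp
  then show ?thesis
    by (simp only: sum_3 add_ac)
qed

lemma all_3_from_0: "(\<forall>s. P s) \<longleftrightarrow> P 0 \<and> P 1 \<and> P (2::3)"
proof -
  have "(3::3) = 0"
    by simp
  then show ?thesis
    by (simp only: forall_3 conj_ac)
qed

lemma UNIV_2_from_0: "(UNIV :: 2 set) = {0, 1}"
proof -
  have "(2::2) = 0"
    by simp
  then show ?thesis
    by (simp only: UNIV_2 insert_commute)
qed

lemma all_2_from_0: "(\<forall>h. P h) \<longleftrightarrow> P 0 \<and> P (1::2)"
  unfolding ball_UNIV[symmetric] UNIV_2_from_0 by simp

lemma sum_2_from_0: "(\<Sum>h\<in>UNIV. f h) = f 0 + f (1::2)"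
  unfolding UNIV_2_from_0 by simp

lemma time_2: "time 0 = (0::2)" "time (Suc 0) = (1::2)"
proof -
  have "(0::2) \<le> 1"
    by (simp add: less_eq_bit0_def bit0.Rep_0 bit0.Rep_1)
  then have "sorted_list_of_set (UNIV :: 2 set) = [0, 1]"
    unfolding UNIV_2_from_0 by simp
  then show "time 0 = (0::2)" "time (Suc 0) = (1::2)"
    by (simp_all add: time_def)
qed

section \<open>Well-formedness and the three assumptions\<close>

lemma dirac_in_prob_simplex: "dirac x \<in> prob_simplex"
  by (simp add: prob_simplex_def dirac_def)

lemma is_mfg_example_game: "is_mfg example_game"
  by (auto simp: is_mfg_def example_game_def dirac_in_prob_simplex split: action.split)

lemma kernel_measure_independent_example_game: "kernel_measure_independent example_game"
  unfolding kernel_measure_independent_def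
  \<comment> \<open>The kernel ignores its measure argument, so any value of it yields the
    witness.\<close>
  by (intro exI[of _ "\<lambda>s a. kernel example_game s a undefined"]) (simp add: example_game_def)

lemma lipschitz_reward_example_game: "lipschitz_reward example_game"
proof -
  have "\<bar>\<mu> s - \<nu> s\<bar> \<le> tv_norm (\<lambda>s'. \<mu> s' - \<nu> s')" for \<mu> \<nu> :: "3 \<Rightarrow> real" and s
    unfolding tv_norm_def by (rule member_le_sum) auto
  moreover have "0 \<le> tv_norm (\<lambda>s'. \<mu> s' - \<nu> s')" for \<mu> \<nu> :: "3 \<Rightarrow> real"
    by (simp add: tv_norm_def sum_nonneg)
  ultimately show ?thesis
    unfolding lipschitz_reward_def
    by (intro exI[of _ 1]) (auto simp: example_game_def abs_minus_commute)
qed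

lemma sum_occupation_flow:
  assumes "is_policy_flow G \<pi>" and "h < horizon G"
  shows "(\<Sum>a\<in>UNIV. occupation_flow G \<pi> h s a) = state_flow G \<pi> h s"
  using assms
  by (simp add: is_policy_flow_def prob_simplex_def occupation_flow_def flip: sum_distrib_right)

text \<open>Rewards do not depend on the action, so the sum over actions collapses to a difference
  of state marginals. Each state then contributes 0 or minus a square.\<close>

lemma weakly_monotone_example_game: "weakly_monotone example_game"
  unfolding weakly_monotone_def
proof (intro allI impI, rule sum_nonpos, rule sum_nonpos)
  fix \<pi> \<pi>' h and s :: 3
  let ?G = example_game
  assume "is_policy_flow ?G \<pi>" "is_policy_flow ?G \<pi>'" "h \<in> {..<horizon ?G}"
  then have marginals: "(\<Sum>a\<in>UNIV. occupation_flow ?G \<pi> h s a - occupation_flow ?G \<pi>' h s a)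
      = state_flow ?G \<pi> h s - state_flow ?G \<pi>' h s"
    by (simp add: sum_subtractf sum_occupation_flow)
  show "(\<Sum>a\<in>UNIV. (reward ?G s a (state_flow ?G \<pi> h) - reward ?G s a (state_flow ?G \<pi>' h)) *
      (occupation_flow ?G \<pi> h s a - occupation_flow ?G \<pi>' h s a)) \<le> 0"
  proof (cases "s = 0")
    case True
    then show ?thesis
      by (simp add: example_game_def)
  next
    case False
    then have reward: "reward ?G s a \<mu> = - \<mu> s" for a \<mu>
      by (simp add: example_game_def)
    have "(\<Sum>a\<in>UNIV. (reward ?G s a (state_flow ?G \<pi> h) - reward ?G s a (state_flow ?G \<pi>' h)) *
        (occupation_flow ?G \<pi> h s a - occupation_flow ?G \<pi>' h s a))
        = - (state_flow ?G \<pi> h s - state_flow ?G \<pi>' h s)\<^sup>2"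
      unfolding reward sum_distrib_left[symmetric] marginals
      by (simp add: power2_eq_square algebra_simps)
    then show ?thesis
      by simp
  qed
qed

section \<open>The polytope and the symmetric segment\<close>

text \<open>The value \<open>p = 1/2\<close> is an equilibrium: there the operator has a constant
  inner product with all points of the polytope. So \<open>p - 1/2\<close> measures the excess over
  equilibrium.\<close>

definition split_flow :: "real \<Rightarrow> real^action^3^2" where
  "split_flow p = (\<chi> h s a.
     if h = 0 then (if s = 0 then (if a = L then p else 1 - p) else 0)
     else (if s = 1 then p / 2 else if s = 2 then (1 - p) / 2 else 0))"

lemma rho0_eq_split_flow: "rho0 = split_flow 1"
  by (simp add: rho0_def split_flow_def time_2 vec_eq_iff all_2_from_0 all_3_from_0 all_action)

abbreviation example_polytope :: "(real^action^3^2) set" where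
  "example_polytope \<equiv> occupation_polytope example_game"

lemma example_polytope_iff:
  "\<rho> \<in> example_polytope \<longleftrightarrow>
     (\<forall>h s a. 0 \<le> \<rho> $ h $ s $ a) \<and>
     (\<forall>a. \<rho> $ 0 $ 1 $ a = 0 \<and> \<rho> $ 0 $ 2 $ a = 0 \<and> \<rho> $ 1 $ 0 $ a = 0) \<and>
     \<rho> $ 0 $ 0 $ L + \<rho> $ 0 $ 0 $ R = 1 \<and>
     \<rho> $ 1 $ 1 $ L + \<rho> $ 1 $ 1 $ R = \<rho> $ 0 $ 0 $ L \<and>
     \<rho> $ 1 $ 2 $ L + \<rho> $ 1 $ 2 $ R = \<rho> $ 0 $ 0 $ R" (is "_ \<longleftrightarrow> ?rhs")
proof -
  have "\<rho> \<in> example_polytope \<longleftrightarrow>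
      (\<forall>h s a. 0 \<le> \<rho> $ h $ s $ a) \<and>
      (\<rho> $ 0 $ 0 $ L + \<rho> $ 0 $ 0 $ R = 1 \<and>
       \<rho> $ 0 $ 1 $ L + \<rho> $ 0 $ 1 $ R = 0 \<and>
       \<rho> $ 0 $ 2 $ L + \<rho> $ 0 $ 2 $ R = 0) \<and>
      \<rho> $ 1 $ 0 $ L + \<rho> $ 1 $ 0 $ R = 0 \<and>
      \<rho> $ 1 $ 1 $ L + \<rho> $ 1 $ 1 $ R = \<rho> $ 0 $ 0 $ L + (\<rho> $ 0 $ 1 $ L + \<rho> $ 0 $ 1 $ R) \<and>
      \<rho> $ 1 $ 2 $ L + \<rho> $ 1 $ 2 $ R = \<rho> $ 0 $ 0 $ R + (\<rho> $ 0 $ 2 $ L + \<rho> $ 0 $ 2 $ R)"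
    by (simp add: occupation_polytope_def example_game_def time_2 sum_3_from_0 sum_action
        less_2_cases_iff all_3_from_0 dirac_def)
  also have "\<dots> \<longleftrightarrow> ?rhs"
    \<comment> \<open>The congruence rule keeps nonnegativity available as an assumption, so that
      vanishing sums over actions force vanishing coordinates.\<close>
    by (rule conj_cong[OF refl]) (auto simp: all_action add_nonneg_eq_0_iff)
  finally show ?thesis .
qed

lemma split_flow_in_polytope:
  assumes "0 \<le> p" "p \<le> 1"
  shows "split_flow p \<in> example_polytope"
  using assms by (simp add: example_polytope_iff split_flow_def)

lemma inner_flow:
  fixes x y :: "real^action^3^2"
  shows "x \<bullet> y = (\<Sum>h\<in>UNIV. \<Sum>s\<in>UNIV. \<Sum>a\<in>UNIV. x $ h $ s $ a * y $ h $ s $ a)"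
  by (simp add: inner_vec_def)

lemma mf_operator_split_flow:
  "mf_operator example_game (split_flow p) =
     (\<chi> h s a. if h = 0 then 0 else if s = 1 then p else if s = 2 then 1 - p else 0)"
  by (auto simp: mf_operator_def example_game_def marginal_def split_flow_def vec_eq_iff sum_action)

text \<open>The formula for \<open>q\<close> makes the displacement orthogonal to the affine space
  cut out by the equality constraints, so the obtuse-angle condition holds with equality. The bounds
  on \<open>q\<close> put this affine projection inside the polytope.\<close>

lemma closest_point_example_polytope:
  assumes "0 \<le> q" "q \<le> 1" and q: "q = (1 - b) * p + b - a * (2 * p - 1) / 3"
  shows "closest_point example_polytope
           ((1 - b) *\<^sub>R split_flow p + b *\<^sub>R rho0 - a *\<^sub>R mf_operator example_game (split_flow p))
         = split_flow q" (is "closest_point _ ?z = _")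
proof (rule closest_point_eqI)
  show "split_flow q \<in> example_polytope"
    using assms(1,2) by (rule split_flow_in_polytope)
next
  fix y
  assume "y \<in> example_polytope"
  then have y: "y $ 0 $ 1 $ c = 0" "y $ 0 $ 2 $ c = 0" "y $ 1 $ 0 $ c = 0"
      "y $ 0 $ 0 $ R = 1 - y $ 0 $ 0 $ L"
      "y $ 1 $ 1 $ R = y $ 0 $ 0 $ L - y $ 1 $ 1 $ L"
      "y $ 1 $ 2 $ R = 1 - y $ 0 $ 0 $ L - y $ 1 $ 2 $ L" for c
    by (auto simp: example_polytope_iff)
  define w where "w = ?z - split_flow q"
  define D where "D = (1 - b) * p + b - q"
  have w: "w $ 0 $ 0 $ L = D" "w $ 0 $ 0 $ R = - D"
      "w $ 1 $ 1 $ c = D / 2 - a * p" "w $ 1 $ 2 $ c = - D / 2 - a * (1 - p)" for c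
    unfolding w_def D_def rho0_eq_split_flow mf_operator_split_flow
    by (simp_all add: split_flow_def algebra_simps add_divide_distrib diff_divide_distrib)
  \<comment> \<open>As \<open>w\<close> is constant over second-stage actions, only the masses of
    states 1 and 2 matter, and these are fixed by the first-stage split.\<close>
  have "w \<bullet> (y - split_flow q) = (3 * D - a * (2 * p - 1)) * (y $ 0 $ 0 $ L - q)"
    by (simp add: inner_flow sum_2_from_0 sum_3_from_0 sum_action w y split_flow_def field_simps)
  also have "\<dots> = 0"
    by (simp add: D_def q)
  finally show "(?z - split_flow q) \<bullet> (y - split_flow q) \<le> 0"
    by (simp add: w_def)
qed

text \<open>Shifting all of the mass \<open>p\<close> to the other branch descends by
  \<open>(2 * p - 1) * p\<close> over a length of \<open>sqrt 3 * p\<close>; the factor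
  \<open>p\<close> cancels.\<close>

lemma tangent_residual_split_flow_ge:
  assumes "0 < p" "p \<le> 1"
  shows "(2 * p - 1) / sqrt 3
    \<le> tangent_residual (mf_operator example_game) example_polytope (split_flow p)"
proof (rule tangent_residual_ge[of "split_flow 0"])
  let ?d = "split_flow 0 - split_flow p"
  have "norm ?d = sqrt (3 * p\<^sup>2)"
    by (simp add: norm_eq_sqrt_inner inner_flow sum_2_from_0 sum_3_from_0 sum_action
        split_flow_def field_simps power2_eq_square)
  then have norm: "norm ?d = sqrt 3 * p"
    using \<open>0 < p\<close> by (simp add: real_sqrt_mult)
  then show "split_flow 0 \<noteq> split_flow p"
    using \<open>0 < p\<close> by auto
  have "mf_operator example_game (split_flow p) \<bullet> ?d = - ((2 * p - 1) * p)"
    unfolding mf_operator_split_flow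
    by (simp add: inner_flow sum_2_from_0 sum_3_from_0 sum_action split_flow_def field_simps)
  then show "(2 * p - 1) / sqrt 3 * norm ?d
      \<le> - (mf_operator example_game (split_flow p) \<bullet> ?d)"
    by (simp add: norm)
qed (simp add: split_flow_in_polytope)

section \<open>The scalar recursion and the trajectory\<close>

text \<open>
  Here \<open>m\<close> stands for $k + 2$ and \<open>u\<close> for $u_k$; the factor $1 - \beta_k - 2\alpha_k/3$ is negative
  at $k = 0$, where $u_0 = 1/2$ is known exactly.
\<close>

lemma excess_step:
  fixes m u :: real
  assumes "3 \<le> m" and lower: "1 / (2 * sqrt m) \<le> u" and upper: "u \<le> 1 / 2"
  defines "u' \<equiv> (1 - 2 / m - 1 / (9 * sqrt m)) * u + 1 / m"
  shows "1 / (2 * sqrt (m + 1)) \<le> u'" "u' \<le> 1 / 2"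
proof -
  define s where "s = sqrt m"
  have m: "m = s\<^sup>2"
    using \<open>3 \<le> m\<close> by (simp add: s_def)
  have "3 / 2 \<le> s"
    unfolding s_def using \<open>3 \<le> m\<close> by (intro real_le_rsqrt) (simp add: power2_eq_square)
  then have "0 < s" by simp
  \<comment> \<open>With a nonnegative coefficient the update is monotone in \<open>u\<close>, so
    both bounds can be pushed through it.\<close>
  have coeff: "0 \<le> 1 - 2 / m - 1 / (9 * s)"
  proof -
    have "2 / m \<le> 2 / 3" using \<open>3 \<le> m\<close> by (intro divide_left_mono) auto
    moreover have "1 / (9 * s) \<le> 1 / 3" using \<open>3 / 2 \<le> s\<close> by (intro divide_left_mono) auto
    ultimately show ?thesis by linarith
  qed
  have "(1 - 2 / m - 1 / (9 * s)) * u \<le> (1 - 2 / m - 1 / (9 * s)) * (1 / 2)"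
    using coeff upper by (rule mult_left_mono[rotated])
  then have "u' \<le> 1 / 2 - 1 / (18 * s)"
    by (simp add: u'_def s_def algebra_simps)
  also have "\<dots> \<le> 1 / 2"
    using \<open>0 < s\<close> by simp
  finally show "u' \<le> 1 / 2" .
  have "1 / (2 * sqrt (m + 1)) \<le> 1 / (2 * s)"
    unfolding s_def using \<open>3 \<le> m\<close> by (intro divide_left_mono) auto
  \<comment> \<open>Inserting \<open>u = 1 / (2 * s)\<close> into the update, the anchor gains
    \<open>1 / m\<close> while the contraction loses \<open>1 / (s * m)\<close> and
    \<open>1 / (18 * m)\<close>; the net gain is nonnegative.\<close>
  also have "\<dots> \<le> 1 / (2 * s) + (17 / 18 - 1 / s) / m"
  proof -
    have "1 / s \<le> 2 / 3" using divide_left_mono[OF \<open>3 / 2 \<le> s\<close>, of 1] \<open>0 < s\<close> by simp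
    then have "1 / s \<le> 17 / 18" by linarith
    then show ?thesis using \<open>3 \<le> m\<close> by simp
  qed
  also have "\<dots> = (1 - 2 / m - 1 / (9 * s)) * (1 / (2 * s)) + 1 / m"
    using \<open>0 < s\<close> by (simp add: m field_simps power2_eq_square)
  also have "\<dots> \<le> u'"
    unfolding u'_def s_def[symmetric]
    using mult_left_mono[OF lower[folded s_def] coeff] by simp
  finally show "1 / (2 * sqrt (m + 1)) \<le> u'" .
qed

text \<open>The right-hand side is the excess after the first step: at \<open>k = 0\<close> the
  coefficient is \<open>- 1 / (9 * sqrt 2)\<close> and the anchor adds 1/2. This starts the
  induction.\<close>

lemma excess_first_step:
  "1 / (2 * sqrt 3) \<le> 1 / 2 - 1 / (18 * sqrt (2::real))"
proof -
  have "3 / 2 \<le> sqrt (3::real)" "1 \<le> sqrt (2::real)"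
    by (intro real_le_rsqrt; simp add: power2_eq_square)+
  then have "1 / (2 * sqrt (3::real)) \<le> 1 / 3" "1 / (18 * sqrt (2::real)) \<le> 1 / 18"
    using divide_left_mono[of "3 / 2" "sqrt 3" "1 / 2 :: real"]
      divide_left_mono[of 1 "sqrt 2" "1 / 18 :: real"] by simp_all
  then show ?thesis
    by linarith
qed

lemma iterate_on_segment:
  fixes \<rho> :: "nat \<Rightarrow> real^action^3^2" and \<alpha> \<beta> :: "nat \<Rightarrow> real"
  assumes \<alpha>: "\<And>k. \<alpha> k = 1 / (6 * sqrt (real k + 2))"
    and \<beta>: "\<And>k. \<beta> k = 2 / (real k + 2)"
    and init: "\<rho> 0 = rho0"
    and step: "\<And>k. \<rho> (Suc k) = closest_point example_polytope
       ((1 - \<beta> k) *\<^sub>R \<rho> k + \<beta> k *\<^sub>R rho0 - \<alpha> k *\<^sub>R mf_operator example_game (\<rho> k))"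
    and "1 \<le> k"
  shows "\<exists>u. \<rho> k = split_flow (1 / 2 + u) \<and> 1 / (2 * sqrt (real k + 2)) \<le> u \<and> u \<le> 1 / 2"
proof -
  \<comment> \<open>The bounds on \<open>v\<close> keep \<open>1 / 2 + v\<close> in the unit
    interval, where the explicit projection formula applies.\<close>
  have excess: "\<rho> (Suc k) = split_flow (1 / 2 + v)"
    if "\<rho> k = split_flow (1 / 2 + u)" "1 / (2 * sqrt (real k + 3)) \<le> v" "v \<le> 1 / 2"
      and v: "v = (1 - 2 / (real k + 2) - 1 / (9 * sqrt (real k + 2))) * u + 1 / (real k + 2)"
    for k u v
    unfolding step that(1)
  proof (rule closest_point_example_polytope)
    have "0 \<le> 1 / (2 * sqrt (real k + 3))"
      by simp
    then show "0 \<le> 1 / 2 + v" "1 / 2 + v \<le> 1"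
      using that(2,3) by linarith+
    \<comment> \<open>The operator term is \<open>2 * \<alpha> k / 3 * u\<close>, whence the 1/9;
      the anchor \<open>rho0\<close> has excess 1/2 and contributes
      \<open>\<beta> k / 2\<close>.\<close>
    show "1 / 2 + v = (1 - \<beta> k) * (1 / 2 + u) + \<beta> k - \<alpha> k * (2 * (1 / 2 + u) - 1) / 3"
      unfolding v \<alpha> \<beta> by (simp add: divide_simps) (simp add: algebra_simps)
  qed
  show ?thesis
    using \<open>1 \<le> k\<close>
  proof (induction k rule: dec_induct)
    case base
    have "\<rho> (Suc 0) = split_flow (1 / 2 + (1 / 2 - 1 / (18 * sqrt 2)))"
      by (rule excess[where u = "1 / 2"])
        (use excess_first_step in \<open>simp_all add: init rho0_eq_split_flow\<close>)
    then show ?case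
      using excess_first_step by (intro exI[of _ "1 / 2 - 1 / (18 * sqrt 2)"]) simp
  next
    case (step k)
    then obtain u where u: "\<rho> k = split_flow (1 / 2 + u)"
        "1 / (2 * sqrt (real k + 2)) \<le> u" "u \<le> 1 / 2"
      by blast
    have "3 \<le> real k + 2"
      using step.hyps by simp
    note bounds = excess_step[OF this u(2,3)]
    have "real (Suc k) + 2 = real k + 3" "real k + 2 + 1 = real k + 3"
      by simp_all
    then show ?case
      using bounds excess[OF u(1) _ bounds(2) refl] by metis
  qed
qed

section \<open>The asymptotic rate\<close>

text \<open>The constant 1/3 works because \<open>3 * (k + 2) \<le> 9 * k\<close> once
  \<open>k\<close> is at least 1.\<close>

lemma sqrt_rate_bigomega:
  fixes f :: "nat \<Rightarrow> real"
  assumes "\<And>k. 1 \<le> k \<Longrightarrow> 1 / sqrt (3 * (real k + 2)) \<le> f k"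
  shows "f \<in> \<Omega>(\<lambda>k. real k powr (-1/2))"
proof (rule landau_omega.bigI[of "1 / 3"])
  show "eventually (\<lambda>k. norm (f k) \<ge> 1 / 3 * norm (real k powr (-1/2))) at_top"
    using eventually_ge_at_top[of 1]
  proof eventually_elim
    case (elim k)
    have "real k powr (-1/2) = 1 / sqrt (real k)"
      using elim by (simp add: powr_minus_divide powr_half_sqrt flip: minus_divide_left)
    then have "1 / 3 * norm (real k powr (-1/2)) = 1 / sqrt (9 * real k)"
      by (simp add: real_sqrt_mult)
    also have "\<dots> \<le> 1 / sqrt (3 * (real k + 2))"
      using elim by (intro divide_left_mono) auto
    also have "\<dots> \<le> norm (f k)"
      using assms[OF elim] by simp
    finally show ?case .
  qed
qed simp

theorem proposition2:
  shows
    "is_mfg example_game \<and>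
     weakly_monotone example_game \<and>
     kernel_measure_independent example_game \<and>
     lipschitz_reward example_game \<and>
     rho0 \<in> (occupation_polytope example_game :: (real^action^3^2) set) \<and>
     (\<forall>(\<K> :: (real^action^3^2) set) (F :: real^action^3^2 \<Rightarrow> real^action^3^2)
        (\<alpha> :: nat \<Rightarrow> real) (\<beta> :: nat \<Rightarrow> real) (\<rho> :: nat \<Rightarrow> real^action^3^2).
        \<K> = occupation_polytope example_game \<longrightarrow>
        F = mf_operator example_game \<longrightarrow>
        (\<forall>k. \<alpha> k = 1 / (6 * sqrt (real k + 2))) \<longrightarrow>
        (\<forall>k. \<beta> k = 2 / (real k + 2)) \<longrightarrow>
        \<rho> 0 = rho0 \<longrightarrow>
        (\<forall>k. \<rho> (Suc k) =
           closest_point \<K> ((1 - \<beta> k) *\<^sub>R \<rho> k + \<beta> k *\<^sub>R rho0 - \<alpha> k *\<^sub>R F (\<rho> k))) \<longrightarrow>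
        (\<forall>k\<ge>1. tangent_residual F \<K> (\<rho> k) \<ge> 1 / sqrt (3 * (real k + 2))) \<and>
        (\<lambda>k. tangent_residual F \<K> (\<rho> k)) \<in> \<Omega>(\<lambda>k. real k powr (-1/2)))"
proof (intro conjI allI impI)
  show "is_mfg example_game"
    by (rule is_mfg_example_game)
  show "weakly_monotone example_game"
    by (rule weakly_monotone_example_game)
  show "kernel_measure_independent example_game"
    by (rule kernel_measure_independent_example_game)
  show "lipschitz_reward example_game"
    by (rule lipschitz_reward_example_game)
  show "rho0 \<in> example_polytope"
    by (simp add: rho0_eq_split_flow split_flow_in_polytope)
next
  fix \<K> :: "(real^action^3^2) set" and F :: "real^action^3^2 \<Rightarrow> real^action^3^2"
    and \<alpha> \<beta> :: "nat \<Rightarrow> real" and \<rho> :: "nat \<Rightarrow> real^action^3^2"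
  assume \<K>: "\<K> = example_polytope" and F: "F = mf_operator example_game"
    and "\<forall>k. \<alpha> k = 1 / (6 * sqrt (real k + 2))" "\<forall>k. \<beta> k = 2 / (real k + 2)"
    and "\<rho> 0 = rho0"
    and "\<forall>k. \<rho> (Suc k) =
      closest_point \<K> ((1 - \<beta> k) *\<^sub>R \<rho> k + \<beta> k *\<^sub>R rho0 - \<alpha> k *\<^sub>R F (\<rho> k))"
  then have segment: "\<exists>u. \<rho> k = split_flow (1 / 2 + u) \<and> 1 / (2 * sqrt (real k + 2)) \<le> u \<and> u \<le> 1 / 2"
    if "1 \<le> k" for k
    using that by (intro iterate_on_segment) auto
  show lower: "1 / sqrt (3 * (real k + 2)) \<le> tangent_residual F \<K> (\<rho> k)" if k: "1 \<le> k" for k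
  proof -
    obtain u where u: "\<rho> k = split_flow (1 / 2 + u)" "1 / (2 * sqrt (real k + 2)) \<le> u" "u \<le> 1 / 2"
      using segment[OF k] by blast
    have "0 < 1 / (2 * sqrt (real k + 2))"
      by simp
    then have "0 < 1 / 2 + u"
      using u(2) by linarith
    \<comment> \<open>At \<open>p = 1 / 2 + u\<close> the residual bound reads
      \<open>2 * u / sqrt 3\<close>, so the lower bound on \<open>u\<close> gives exactly the
      claimed constant.\<close>
    have "1 / sqrt (3 * (real k + 2)) = 2 * (1 / (2 * sqrt (real k + 2))) / sqrt 3"
      by (subst real_sqrt_mult) simp
    also have "\<dots> \<le> (2 * (1 / 2 + u) - 1) / sqrt 3"
      using u(2) by (intro divide_right_mono) auto
    also have "\<dots> \<le> tangent_residual F \<K> (\<rho> k)"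
      unfolding \<K> F u(1) using \<open>0 < 1 / 2 + u\<close> u(3)
      by (intro tangent_residual_split_flow_ge) auto
    finally show ?thesis .
  qed
  show "(\<lambda>k. tangent_residual F \<K> (\<rho> k)) \<in> \<Omega>(\<lambda>k. real k powr (-1/2))"
    using lower by (rule sqrt_rate_bigomega)
qed

end
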